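(* Let $G$ be a multigraph whose underlying simple graph is $K_4$. Let $u\in V(G)$ and write $V(G)\setminus\{u\}=\{v_1,v_2,v_3\}$. Then: (i) $G$ is $K_3$-decomposable if and only if there exists an integer $n$ with $0\le n\le \min\{\mu(v_i,v_j): i,j\in\{1,2,3\}, i\ne j\}$ such that $\mu(u,v_i)=\mu(v_i,v_j)+\mu(v_i,v_k)-2n$ for every $i\in\{1,2,3\}$, where $\{j,k\}=\{1,2,3\}\setminus\{i\}$; (ii) $G$ is rationally $K_3$-decomposable if and only if there exists an integer $n'$ with $0\le \tfrac{n'}{2}\le \min\{\mu(v_i,v_j): i,j\in\{1,2,3\}, i\ne j\}$ such that $\mu(u,v_i)=\mu(v_i,v_j)+\mu(v_i,v_k)-n'$ for every $i\in\{1,2,3\}$, where $\{j,k\}=\{1,2,3\}\setminus\{i\}$. Moreover, if $G$ is rationally $K_3$-decomposable, then it has a rational $K_3$-decomposition using only weights $0$, $1$ and $\tfrac12$.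
   Context: A multigraph may have multiple edges but no loops; $\mu(x,y)$ denotes the number of edges joining vertices $x$ and $y$ (so here $\mu(x,y)\ge1$ for all distinct $x,y$). A triangle of a multigraph is a set of three edges joining three vertices pairwise (different choices of parallel edges give different triangles). $G$ is $K_3$-decomposable if its edge set can be partitioned into triangles. A rational $K_3$-decomposition is an assignment of nonnegative rational weights to the triangles of $G$ such that for every edge $e$, the sum of the weights of the triangles containing $e$ equals $1$; $G$ is rationally $K_3$-decomposable if such an assignment exists. *)

theory Defs
  imports Complex_Main "HOL-Library.Disjoint_Sets"
begin

text \<open>Edges are objects of their own, so that parallel edges are distinguished;
  \<open>ends G e\<close> is the set of the two endpoints of \<open>e\<close>.\<close>

record ('v, 'e) pre_multigraph =
  verts :: "'v set"
  edges :: "'e set"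
  ends :: "'e \<Rightarrow> 'v set"

locale multigraph =
  fixes G :: "('v, 'e) pre_multigraph"
  assumes finite_verts: "finite (verts G)"
    and finite_edges: "finite (edges G)"
    and ends_subset: "e \<in> edges G \<Longrightarrow> ends G e \<subseteq> verts G"
    and no_loops: "e \<in> edges G \<Longrightarrow> card (ends G e) = 2"

definition mu :: "('v, 'e) pre_multigraph \<Rightarrow> 'v \<Rightarrow> 'v \<Rightarrow> nat" where
  "mu G x y = card {e \<in> edges G. ends G e = {x, y}}"

text \<open>The edge set of the underlying simple graph is \<open>ends G ` edges G\<close>.\<close>

definition underlying_K4 :: "('v, 'e) pre_multigraph \<Rightarrow> bool" where
  "underlying_K4 G \<longleftrightarrow>
     card (verts G) = 4 \<and> ends G ` edges G = {S. S \<subseteq> verts G \<and> card S = 2}"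

definition triangles :: "('v, 'e) pre_multigraph \<Rightarrow> 'e set set" where
  "triangles G = {{e, f, g} | e f g. e \<in> edges G \<and> f \<in> edges G \<and> g \<in> edges G \<and>
     (\<exists>x y z. x \<noteq> y \<and> y \<noteq> z \<and> x \<noteq> z \<and>
        ends G e = {x, y} \<and> ends G f = {y, z} \<and> ends G g = {x, z})}"

definition K3_decomposable :: "('v, 'e) pre_multigraph \<Rightarrow> bool" where
  "K3_decomposable G \<longleftrightarrow> (\<exists>P. partition_on (edges G) P \<and> P \<subseteq> triangles G)"

text \<open>The values of \<open>w\<close> outside \<open>triangles G\<close> are irrelevant.\<close>

definition rational_K3_decomposition :: "('v, 'e) pre_multigraph \<Rightarrow> ('e set \<Rightarrow> rat) \<Rightarrow> bool" where
  "rational_K3_decomposition G w \<longleftrightarrow>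
     (\<forall>T \<in> triangles G. 0 \<le> w T) \<and>
     (\<forall>e \<in> edges G. (\<Sum>T \<in> {T \<in> triangles G. e \<in> T}. w T) = 1)"

definition rationally_K3_decomposable :: "('v, 'e) pre_multigraph \<Rightarrow> bool" where
  "rationally_K3_decomposable G \<longleftrightarrow> (\<exists>w. rational_K3_decomposition G w)"

end

theory Submission imports Defs begin

text \<open>Call a triangle of type \<open>x\<close> if \<open>x\<close> is the vertex that it misses, and let \<open>t x\<close> be the total
  weight of the triangles of type \<open>x\<close>. Counting the edges with end set \<open>S\<close> gives
  \<open>\<mu>(S) = (\<Sum>x \<in> V - S. t x)\<close>; eliminating the \<open>t v\<^sub>i\<close> yields the conditions with \<open>n = t u\<close>.
  Conversely, nonnegative integers \<open>t x\<close> with this property give a decomposition: for each \<open>S\<close>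
  label the edges with end set \<open>S\<close> bijectively by the pairs \<open>(x, i)\<close> with \<open>x \<in> V - S\<close>, \<open>i < t x\<close>;
  then the edges with a common label form a triangle. In the rational case the numbers \<open>2 * t x\<close>
  are integers, so the multigraph with all edges doubled is decomposable, and its triangles
  induce weights in \<open>{0, 1/2, 1}\<close> because every edge has only two copies.\<close>

definition edge_class :: "('v, 'e) pre_multigraph \<Rightarrow> 'v set \<Rightarrow> 'e set" where
  "edge_class G S = {e \<in> edges G. ends G e = S}"

lemma mu_eq_card_edge_class: "mu G x y = card (edge_class G {x, y})"
  by (simp add: mu_def edge_class_def)

lemma mu_commute: "mu G x y = mu G y x"
  by (simp add: mu_def insert_commute)

lemma pair_subset_triple:
  assumes "S \<subseteq> {p, q, r}" "card S = 2"
  shows "S = {p, q} \<or> S = {q, r} \<or> S = {p, r}"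
  using assms by (auto simp: card_2_iff doubleton_eq_iff)

lemma pair_subset_quadruple:
  assumes "S \<subseteq> {u, a, b, c}" "card S = 2"
  shows "S \<in> {{u, a}, {u, b}, {u, c}, {a, b}, {b, c}, {a, c}}"
proof -
  obtain x y where "S = {x, y}" "x \<noteq> y"
    using assms(2) by (auto simp: card_2_iff)
  moreover have "x \<in> {u, a, b, c}" "y \<in> {u, a, b, c}"
    using assms(1) \<open>S = {x, y}\<close> by blast+
  ultimately show ?thesis
    by (elim insertE emptyE) (simp_all add: insert_commute)
qed

lemma finite_triangles:
  assumes "multigraph G"
  shows "finite (triangles G)"
  by (rule finite_subset[of _ "Pow (edges G)"])
    (auto simp: triangles_def multigraph.finite_edges[OF assms])

lemma triangle_type:
  assumes G: "multigraph G" and V: "card (verts G) = 4" and T: "T \<in> triangles G"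
  shows "\<exists>x \<in> verts G. \<Union> (ends G ` T) = verts G - {x} \<and>
    (\<forall>S. S \<subseteq> verts G \<and> card S = 2 \<longrightarrow>
       card (T \<inter> edge_class G S) = (if x \<in> S then 0 else 1))"
proof -
  obtain e f g p q r where efg: "T = {e, f, g}" "e \<in> edges G" "f \<in> edges G" "g \<in> edges G"
    and d: "p \<noteq> q" "q \<noteq> r" "p \<noteq> r"
    and en: "ends G e = {p, q}" "ends G f = {q, r}" "ends G g = {p, r}"
    using T unfolding triangles_def by auto
  have W: "\<Union> (ends G ` T) = {p, q, r}"
    using efg en by auto
  have sub: "{p, q, r} \<subseteq> verts G"
    using multigraph.ends_subset[OF G] efg en by blast
  have "card (verts G - {p, q, r}) = 1"
    using V d by (subst card_Diff_subset) (use sub in auto)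
  then obtain x where x: "verts G - {p, q, r} = {x}"
    by (auto simp: card_1_singleton_iff)
  have "card (T \<inter> edge_class G S) = (if x \<in> S then 0 else 1)"
    if S: "S \<subseteq> verts G" "card S = 2" for S
  proof (cases "x \<in> S")
    case True
    then have "T \<inter> edge_class G S = {}"
      using x efg en by (auto simp: edge_class_def)
    then show ?thesis using True by simp
  next
    case False
    have "S - {p, q, r} \<subseteq> {x}"
      unfolding x[symmetric] using S(1) by (rule Diff_mono) simp
    with False have "S \<subseteq> {p, q, r}" by auto
    have ne: "{p, q} \<noteq> {q, r}" "{q, r} \<noteq> {p, r}" "{p, q} \<noteq> {p, r}"
      using d by (simp_all add: doubleton_eq_iff)
    have "T \<inter> edge_class G {p, q} = {e}" "T \<inter> edge_class G {q, r} = {f}"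
      "T \<inter> edge_class G {p, r} = {g}"
      unfolding efg(1) edge_class_def
      using efg(2-4) by (simp_all add: Int_insert_left en ne ne[symmetric])
    then have "T \<inter> edge_class G S = {e} \<or> T \<inter> edge_class G S = {f} \<or> T \<inter> edge_class G S = {g}"
      using pair_subset_triple[OF \<open>S \<subseteq> {p, q, r}\<close> S(2)] by metis
    then show ?thesis using False by auto
  qed
  moreover have "\<Union> (ends G ` T) = verts G - {x}" "x \<in> verts G"
    using W x sub by auto
  ultimately show ?thesis by blast
qed

lemma triangleI:
  assumes G: "multigraph G" and V: "card (verts G) = 4" and T: "T \<subseteq> edges G"
    and x: "x \<in> verts G"
    and meet: "\<And>S. S \<subseteq> verts G \<Longrightarrow> card S = 2 \<Longrightarrow>
      card (T \<inter> edge_class G S) = (if x \<in> S then 0 else 1)"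
  shows "T \<in> triangles G"
proof -
  have finT: "finite T"
    using T multigraph.finite_edges[OF G] finite_subset by blast
  have "card (verts G - {x}) = 3"
    using V x by simp
  then obtain p q r where W: "verts G - {x} = {p, q, r}" and d: "p \<noteq> q" "q \<noteq> r" "p \<noteq> r"
    by (auto simp: card_3_iff)
  have single: "\<exists>e. T \<inter> edge_class G {y, z} = {e}"
    if "y \<in> {p, q, r}" "z \<in> {p, q, r}" "y \<noteq> z" for y z
  proof -
    have "{y, z} \<subseteq> verts G" "x \<notin> {y, z}"
      using that(1,2) unfolding W[symmetric] by auto
    then show ?thesis
      using meet[of "{y, z}"] that(3) by (auto simp: card_1_singleton_iff)
  qed
  obtain e f g where
    efg: "T \<inter> edge_class G {p, q} = {e}" "T \<inter> edge_class G {q, r} = {f}"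
      "T \<inter> edge_class G {p, r} = {g}"
    using single[of p q] single[of q r] single[of p r] d by auto
  have "h \<in> {e, f, g}" if h: "h \<in> T" for h
  proof -
    have hE: "h \<in> edges G" using h T by blast
    have S: "ends G h \<subseteq> verts G" "card (ends G h) = 2"
      using multigraph.ends_subset[OF G hE] multigraph.no_loops[OF G hE] by auto
    have hS: "h \<in> T \<inter> edge_class G (ends G h)"
      using h hE by (simp add: edge_class_def)
    have "x \<notin> ends G h"
    proof
      assume "x \<in> ends G h"
      then have "card (T \<inter> edge_class G (ends G h)) = 0"
        using meet[OF S] by simp
      then show False using hS finT by auto
    qed
    then have "ends G h \<subseteq> {p, q, r}" using S(1) W by blast
    from pair_subset_triple[OF this S(2)] show ?thesis
      using hS efg by auto
  qed
  then have "T = {e, f, g}" using efg by blast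
  moreover have "e \<in> edges G" "f \<in> edges G" "g \<in> edges G"
    "ends G e = {p, q}" "ends G f = {q, r}" "ends G g = {p, r}"
    using efg by (auto simp: edge_class_def)
  ultimately show ?thesis
    unfolding triangles_def using d by blast
qed

lemma card_edge_class_eq_sum_types:
  assumes G: "multigraph G" and V: "card (verts G) = 4"
    and w: "rational_K3_decomposition G w"
    and S: "S \<subseteq> verts G" "card S = 2"
  shows "of_nat (card (edge_class G S)) =
    (\<Sum>x \<in> verts G - S. \<Sum>T \<in> {T \<in> triangles G. x \<notin> \<Union> (ends G ` T)}. w T)"
proof -
  have fin: "finite (triangles G)" "finite (verts G)" "finite (edge_class G S)"
    using finite_triangles[OF G] multigraph.finite_verts[OF G] multigraph.finite_edges[OF G]
    by (auto simp: edge_class_def)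
  have "of_nat (card (edge_class G S)) =
      (\<Sum>e \<in> edge_class G S. \<Sum>T \<in> {T \<in> triangles G. e \<in> T}. w T)"
    using w by (simp add: rational_K3_decomposition_def edge_class_def)
  also have "\<dots> = (\<Sum>T \<in> triangles G. \<Sum>e \<in> {e \<in> edge_class G S. e \<in> T}. w T)"
    by (rule sum.swap_restrict) (use fin in auto)
  also have "\<dots> = (\<Sum>T \<in> triangles G.
      \<Sum>x \<in> {x \<in> verts G - S. x \<notin> \<Union> (ends G ` T)}. w T)"
  proof (rule sum.cong[OF refl])
    fix T assume "T \<in> triangles G"
    from triangle_type[OF G V this] obtain x where x: "x \<in> verts G"
      "\<Union> (ends G ` T) = verts G - {x}"
      "card (T \<inter> edge_class G S) = (if x \<in> S then 0 else 1)"
      using S by blast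
    have E: "{e \<in> edge_class G S. e \<in> T} = T \<inter> edge_class G S" by auto
    have X: "{y \<in> verts G - S. y \<notin> \<Union> (ends G ` T)} = {x} - S"
      using x(1,2) by auto
    show "(\<Sum>e \<in> {e \<in> edge_class G S. e \<in> T}. w T) =
        (\<Sum>x \<in> {x \<in> verts G - S. x \<notin> \<Union> (ends G ` T)}. w T)"
      unfolding E X using x(3) by (cases "x \<in> S") (simp_all add: insert_Diff_if)
  qed
  also have "\<dots> = (\<Sum>x \<in> verts G - S. \<Sum>T \<in> {T \<in> triangles G. x \<notin> \<Union> (ends G ` T)}. w T)"
    by (rule sum.swap_restrict[symmetric]) (use fin in auto)
  finally show ?thesis .
qed

lemma indicator_rational_K3_decomposition:
  assumes G: "multigraph G" and P: "partition_on (edges G) P" "P \<subseteq> triangles G"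
  shows "rational_K3_decomposition G (\<lambda>T. of_bool (T \<in> P))"
proof -
  have "(\<Sum>T \<in> {T \<in> triangles G. e \<in> T}. of_bool (T \<in> P)) = (1 :: rat)"
    if e: "e \<in> edges G" for e
  proof -
    obtain T where T: "T \<in> P" "e \<in> T"
      using e partition_onD1[OF P(1)] by auto
    have "{T \<in> triangles G. e \<in> T} \<inter> {T. T \<in> P} = {T}"
      using T P partition_onD2[OF P(1)] by (auto simp: disjoint_def)
    then show ?thesis
      using finite_triangles[OF G] by simp
  qed
  then show ?thesis by (simp add: rational_K3_decomposition_def)
qed

lemma K3_decomposable_if_card_edge_class:
  assumes G: "multigraph G" and V: "card (verts G) = 4"
    and t: "\<And>S. S \<subseteq> verts G \<Longrightarrow> card S = 2 \<Longrightarrow>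
      card (edge_class G S) = (\<Sum>x \<in> verts G - S. t x)"
  shows "K3_decomposable G"
proof -
  have finV: "finite (verts G)" and finE: "finite (edges G)"
    using G by (auto simp: multigraph_def)
  define L where "L S = (SIGMA x:verts G - S. {..<t x})" for S
  have "\<exists>h. bij_betw h (edge_class G S) (L S)" if "S \<subseteq> verts G" "card S = 2" for S
    by (rule finite_same_card_bij)
      (use finV finE t[OF that] in \<open>auto simp: L_def edge_class_def\<close>)
  then obtain H where H: "\<And>S. S \<subseteq> verts G \<Longrightarrow> card S = 2 \<Longrightarrow>
      bij_betw (H S) (edge_class G S) (L S)"
    by metis
  define F where "F z = {e \<in> edges G. H (ends G e) e = z}" for z
  have label: "H (ends G e) e \<in> L {}" if e: "e \<in> edges G" for e
  proof -
    have "e \<in> edge_class G (ends G e)" using e by (simp add: edge_class_def)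
    then have "H (ends G e) e \<in> L (ends G e)"
      using H[OF multigraph.ends_subset[OF G e] multigraph.no_loops[OF G e]]
      by (auto dest: bij_betwE)
    then show ?thesis by (auto simp: L_def)
  qed
  have tri: "F z \<in> triangles G" if z: "z \<in> L {}" for z
  proof (rule triangleI[OF G V])
    show "F z \<subseteq> edges G" by (auto simp: F_def)
    show "fst z \<in> verts G" using z by (auto simp: L_def)
    fix S assume S: "S \<subseteq> verts G" "card S = 2"
    have F: "F z \<inter> edge_class G S = {e \<in> edge_class G S. H S e = z}"
      by (auto simp: F_def edge_class_def)
    have iff: "z \<in> L S \<longleftrightarrow> fst z \<notin> S" using z by (auto simp: L_def)
    show "card (F z \<inter> edge_class G S) = (if fst z \<in> S then 0 else 1)"
    proof (cases "fst z \<in> S")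
      case True
      then have "{e \<in> edge_class G S. H S e = z} = {}"
        using H[OF S] iff by (auto dest: bij_betwE)
      then show ?thesis unfolding F using True by (simp only: card.empty if_True)
    next
      case False
      then have "z \<in> H S ` edge_class G S"
        using H[OF S] iff by (simp add: bij_betw_def)
      then obtain e where "e \<in> edge_class G S" "H S e = z" by blast
      then have "{e \<in> edge_class G S. H S e = z} = {e}"
        using H[OF S] by (auto simp: bij_betw_def inj_on_def)
      then show ?thesis unfolding F using False by simp
    qed
  qed
  have "partition_on (edges G) (F ` L {})"
  proof (rule partition_onI)
    show "\<Union> (F ` L {}) = edges G" using label by (auto simp: F_def)
    have "{} \<notin> triangles G" by (auto simp: triangles_def)
    then show "{} \<notin> F ` L {}" using tri by (metis imageE)
    show "disjnt p p'" if "p \<in> F ` L {}" "p' \<in> F ` L {}" "p \<noteq> p'" for p p'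
      using that by (auto simp: F_def disjnt_def)
  qed
  then show ?thesis
    using tri unfolding K3_decomposable_def by blast
qed

definition doubled :: "('v, 'e) pre_multigraph \<Rightarrow> ('v, 'e \<times> bool) pre_multigraph" where
  "doubled G = \<lparr>verts = verts G, edges = edges G \<times> UNIV, ends = ends G \<circ> fst\<rparr>"

lemma doubled_simps [simp]:
  "verts (doubled G) = verts G" "edges (doubled G) = edges G \<times> UNIV"
  "ends (doubled G) e = ends G (fst e)"
  by (simp_all add: doubled_def)

lemma multigraph_doubled: "multigraph G \<Longrightarrow> multigraph (doubled G)"
  by (auto simp: multigraph_def)

lemma card_edge_class_doubled: "card (edge_class (doubled G) S) = 2 * card (edge_class G S)"
proof -
  have "edge_class (doubled G) S = edge_class G S \<times> UNIV"
    by (auto simp: edge_class_def)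
  then show ?thesis by (simp add: card_cartesian_product)
qed

lemma triangle_doubled:
  assumes "T \<in> triangles (doubled G)"
  shows "fst ` T \<in> triangles G" and "inj_on fst T"
proof -
  obtain e f g x y z where *: "T = {e, f, g}" "e \<in> edges (doubled G)" "f \<in> edges (doubled G)"
    "g \<in> edges (doubled G)" "x \<noteq> y" "y \<noteq> z" "x \<noteq> z"
    "ends G (fst e) = {x, y}" "ends G (fst f) = {y, z}" "ends G (fst g) = {x, z}"
    using assms by (auto simp: triangles_def)
  then show "inj_on fst T"
    by (auto simp: inj_on_def doubleton_eq_iff)
  have "fst ` T = {fst e, fst f, fst g}" "fst e \<in> edges G" "fst f \<in> edges G" "fst g \<in> edges G"
    using * by auto
  with * show "fst ` T \<in> triangles G"
    unfolding triangles_def by blast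
qed

lemma half_integral_decomposition:
  fixes G :: "('v, 'e) pre_multigraph"
  assumes G: "multigraph G" and "K3_decomposable (doubled G)"
  shows "\<exists>w. rational_K3_decomposition G w \<and> (\<forall>T \<in> triangles G. w T \<in> {0, 1, 1 / 2})"
proof -
  obtain P where P: "partition_on (edges (doubled G)) P" "P \<subseteq> triangles (doubled G)"
    using assms(2) by (auto simp: K3_decomposable_def)
  have finP: "finite P"
    using P(2) finite_triangles[OF multigraph_doubled[OF G]] finite_subset by blast
  define N where "N T = card {p \<in> P. fst ` p = T}" for T
  have cover: "(\<Sum>T \<in> {T \<in> triangles G. e \<in> T}. N T) = 2" if e: "e \<in> edges G" for e
  proof -
    have "(\<Sum>T \<in> {T \<in> triangles G. e \<in> T}. N T) =
        card (\<Union>T \<in> {T \<in> triangles G. e \<in> T}. {p \<in> P. fst ` p = T})"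
      unfolding N_def by (subst card_UN_disjoint) (use finP finite_triangles[OF G] in auto)
    also have "(\<Union>T \<in> {T \<in> triangles G. e \<in> T}. {p \<in> P. fst ` p = T}) =
        {p \<in> P. e \<in> fst ` p}"
      using P(2) triangle_doubled(1) by blast
    also have "card \<dots> = 2"
    proof -
      have "\<forall>b. \<exists>p \<in> P. (e, b) \<in> p"
        using e partition_onD1[OF P(1)] by auto
      then obtain p where p: "\<And>b. p b \<in> P" "\<And>b. (e, b) \<in> p b"
        by metis
      have unique: "q = p b" if "q \<in> P" "(e, b) \<in> q" for q b
        using that p[of b] partition_onD2[OF P(1)] by (auto simp: disjoint_def)
      have "p True \<noteq> p False"
      proof
        assume eq: "p True = p False"
        have "inj_on fst (p True)"
          using p(1) P(2) triangle_doubled(2) by blast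
        then have "(e, True) = (e, False)"
          by (rule inj_onD) (use p(2)[of True] p(2)[of False] eq in auto)
        then show False by simp
      qed
      moreover have "{q \<in> P. e \<in> fst ` q} = {p True, p False}"
      proof (intro equalityI subsetI)
        fix q assume "q \<in> {q \<in> P. e \<in> fst ` q}"
        then obtain b where "q \<in> P" "(e, b) \<in> q" by auto
        then show "q \<in> {p True, p False}" using unique[of q b] by (cases b) auto
      next
        fix q assume "q \<in> {p True, p False}"
        then show "q \<in> {q \<in> P. e \<in> fst ` q}" using p by force
      qed
      ultimately show ?thesis by simp
    qed
    finally show ?thesis .
  qed
  define w :: "'e set \<Rightarrow> rat" where "w T = of_nat (N T) / 2" for T
  have "(\<Sum>T \<in> {T \<in> triangles G. e \<in> T}. w T) = 1" if "e \<in> edges G" for e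
    unfolding w_def sum_divide_distrib[symmetric] of_nat_sum[symmetric] cover[OF that] by simp
  then have "rational_K3_decomposition G w"
    by (simp add: rational_K3_decomposition_def w_def)
  moreover have "w T \<in> {0, 1, 1 / 2}" if T: "T \<in> triangles G" for T
  proof -
    obtain e where e: "e \<in> T" "e \<in> edges G"
      using T by (auto simp: triangles_def)
    have "N T \<le> (\<Sum>T \<in> {T \<in> triangles G. e \<in> T}. N T)"
      by (rule member_le_sum) (use T e finite_triangles[OF G] in auto)
    then have "N T \<in> {0, 1, 2}" using cover[OF e(2)] by auto
    then show ?thesis by (auto simp: w_def)
  qed
  ultimately show ?thesis by blast
qed

lemma sum_outside_pair:
  fixes t :: "'v \<Rightarrow> 'a :: comm_monoid_add"
  assumes "distinct [u, a, b, c]"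
  shows "sum t ({u, a, b, c} - {u, a}) = t b + t c" "sum t ({u, a, b, c} - {u, b}) = t a + t c"
    "sum t ({u, a, b, c} - {u, c}) = t a + t b" "sum t ({u, a, b, c} - {a, b}) = t u + t c"
    "sum t ({u, a, b, c} - {b, c}) = t u + t a" "sum t ({u, a, b, c} - {a, c}) = t u + t b"
proof -
  have "{u, a, b, c} - {u, a} = {b, c}" "{u, a, b, c} - {u, b} = {a, c}"
    "{u, a, b, c} - {u, c} = {a, b}" "{u, a, b, c} - {a, b} = {u, c}"
    "{u, a, b, c} - {b, c} = {u, a}" "{u, a, b, c} - {a, c} = {u, b}"
    using assms by auto
  then show "sum t ({u, a, b, c} - {u, a}) = t b + t c"
    "sum t ({u, a, b, c} - {u, b}) = t a + t c"
    "sum t ({u, a, b, c} - {u, c}) = t a + t b" "sum t ({u, a, b, c} - {a, b}) = t u + t c"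
    "sum t ({u, a, b, c} - {b, c}) = t u + t a" "sum t ({u, a, b, c} - {a, c}) = t u + t b"
    using assms by simp_all
qed

lemma type_counts_exist:
  fixes G :: "('v, 'e) pre_multigraph" and m :: int and k :: nat
  assumes V: "verts G = {u, a, b, c}" and d: "distinct [u, a, b, c]"
    and m: "0 \<le> m" "m \<le> int (k * mu G a b)" "m \<le> int (k * mu G b c)" "m \<le> int (k * mu G a c)"
    and eq: "int (k * mu G u a) = int (k * mu G a b) + int (k * mu G a c) - 2 * m"
      "int (k * mu G u b) = int (k * mu G a b) + int (k * mu G b c) - 2 * m"
      "int (k * mu G u c) = int (k * mu G a c) + int (k * mu G b c) - 2 * m"
  shows "\<exists>t :: 'v \<Rightarrow> nat. \<forall>S. S \<subseteq> verts G \<and> card S = 2 \<longrightarrow>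
    k * card (edge_class G S) = (\<Sum>x \<in> verts G - S. t x)"
proof -
  define t :: "'v \<Rightarrow> nat" where "t x = nat (if x = u then m else if x = a then int (k * mu G b c) - m
    else if x = b then int (k * mu G a c) - m else int (k * mu G a b) - m)" for x
  have t: "t u = nat m" "t a = nat (int (k * mu G b c) - m)" "t b = nat (int (k * mu G a c) - m)"
    "t c = nat (int (k * mu G a b) - m)"
    using d by (auto simp: t_def)
  have counts: "k * mu G u a = t b + t c" "k * mu G u b = t a + t c" "k * mu G u c = t a + t b"
    "k * mu G a b = t u + t c" "k * mu G b c = t u + t a" "k * mu G a c = t u + t b"
    unfolding t using m eq by linarith+
  have "k * card (edge_class G S) = sum t (verts G - S)"
    if S: "S \<subseteq> verts G" "card S = 2" for S
    using pair_subset_quadruple[OF S(1)[unfolded V] S(2)] unfolding V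
    by (elim insertE emptyE)
      (simp_all only: sum_outside_pair[OF d] counts[unfolded mu_eq_card_edge_class])
  then show ?thesis by blast
qed

lemma type_sums_solve:
  fixes G :: "('v, 'e) pre_multigraph" and t :: "'v \<Rightarrow> rat"
  assumes V: "verts G = {u, a, b, c}" and d: "distinct [u, a, b, c]"
    and t: "\<And>S. S \<subseteq> verts G \<Longrightarrow> card S = 2 \<Longrightarrow>
      of_nat (card (edge_class G S)) = (\<Sum>x \<in> verts G - S. t x)"
    and nonneg: "\<And>x. 0 \<le> t x"
  shows "t u \<le> of_nat (mu G a b)" "t u \<le> of_nat (mu G b c)" "t u \<le> of_nat (mu G a c)"
    "of_nat (mu G u a) = of_nat (mu G a b) + of_nat (mu G a c) - 2 * t u"
    "of_nat (mu G u b) = of_nat (mu G a b) + of_nat (mu G b c) - 2 * t u"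
    "of_nat (mu G u c) = of_nat (mu G a c) + of_nat (mu G b c) - 2 * t u"
proof -
  have mu: "of_nat (mu G x y) = sum t ({u, a, b, c} - {x, y})"
    if "{x, y} \<subseteq> {u, a, b, c}" "x \<noteq> y" for x y
    using t[of "{x, y}"] that by (simp add: mu_eq_card_edge_class V)
  have *: "of_nat (mu G u a) = t b + t c" "of_nat (mu G u b) = t a + t c"
    "of_nat (mu G u c) = t a + t b" "of_nat (mu G a b) = t u + t c"
    "of_nat (mu G b c) = t u + t a" "of_nat (mu G a c) = t u + t b"
    unfolding sum_outside_pair[OF d, symmetric] by (rule mu; use d in simp)+
  show "t u \<le> of_nat (mu G a b)" "t u \<le> of_nat (mu G b c)" "t u \<le> of_nat (mu G a c)"
    "of_nat (mu G u a) = of_nat (mu G a b) + of_nat (mu G a c) - 2 * t u"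
    "of_nat (mu G u b) = of_nat (mu G a b) + of_nat (mu G b c) - 2 * t u"
    "of_nat (mu G u c) = of_nat (mu G a c) + of_nat (mu G b c) - 2 * t u"
    unfolding * using nonneg by simp_all
qed

theorem theorem10:
  fixes G :: "('v, 'e) pre_multigraph" and u :: 'v and v :: "nat \<Rightarrow> 'v"
  assumes "multigraph G"
    and "underlying_K4 G"
    and "u \<in> verts G"
    and "bij_betw v {1, 2, 3} (verts G - {u})"
  shows "(K3_decomposable G \<longleftrightarrow>
      (\<exists>n::int. 0 \<le> n \<and>
         n \<le> int (Min {mu G (v i) (v j) | i j. i \<in> {1, 2, 3} \<and> j \<in> {1, 2, 3} \<and> i \<noteq> j}) \<and>
         (\<forall>i \<in> {1, 2, 3}. \<forall>j k. {j, k} = {1, 2, 3} - {i} \<longrightarrow>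
            int (mu G u (v i)) = int (mu G (v i) (v j)) + int (mu G (v i) (v k)) - 2 * n)))
    \<and> (rationally_K3_decomposable G \<longleftrightarrow>
      (\<exists>n'::int. 0 \<le> rat_of_int n' / 2 \<and>
         rat_of_int n' / 2 \<le>
           rat_of_nat (Min {mu G (v i) (v j) | i j. i \<in> {1, 2, 3} \<and> j \<in> {1, 2, 3} \<and> i \<noteq> j}) \<and>
         (\<forall>i \<in> {1, 2, 3}. \<forall>j k. {j, k} = {1, 2, 3} - {i} \<longrightarrow>
            int (mu G u (v i)) = int (mu G (v i) (v j)) + int (mu G (v i) (v k)) - n')))
    \<and> (rationally_K3_decomposable G \<longrightarrow>
      (\<exists>w. rational_K3_decomposition G w \<and> (\<forall>T \<in> triangles G. w T \<in> {0, 1, 1 / 2})))"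
proof -
  note G = assms(1)
  define a b c where "a = v 1" and "b = v 2" and "c = v 3"
  note abc = a_def[symmetric] b_def[symmetric] c_def[symmetric]
  have rest: "verts G - {u} = {a, b, c}"
    using assms(4) by (auto simp: bij_betw_def a_def b_def c_def)
  then have V: "verts G = {u, a, b, c}"
    using assms(3) by auto
  have d: "distinct [u, a, b, c]"
    using assms(4) rest by (auto simp: bij_betw_def inj_on_def a_def b_def c_def)
  have V4: "card (verts G) = 4"
    using assms(2) by (simp add: underlying_K4_def)
  have pairs: "{(i, j). i \<in> {1, 2, 3} \<and> j \<in> {1, 2, 3} \<and> i \<noteq> j} =
      {(1, 2), (2, 3), (1, 3), (2, 1), (3, 2), (3, 1 :: nat)}"
    by auto
  have "{f i j | i j. Q i j} = (\<lambda>(i, j). f i j) ` {(i, j). Q i j}"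
    for f :: "nat \<Rightarrow> nat \<Rightarrow> nat" and Q
    by auto
  then have "{mu G (v i) (v j) | i j. i \<in> {1, 2, 3} \<and> j \<in> {1, 2, 3} \<and> i \<noteq> j} =
      (\<lambda>(i, j). mu G (v i) (v j)) ` {(i, j). i \<in> {1, 2, 3} \<and> j \<in> {1, 2, 3} \<and> i \<noteq> j}" .
  also have "\<dots> = {mu G a b, mu G b c, mu G a c}"
    unfolding pairs image_insert image_empty prod.case abc
    by (auto simp: mu_commute[of G b a] mu_commute[of G c a] mu_commute[of G c b])
  finally have Min: "Min {mu G (v i) (v j) | i j. i \<in> {1, 2, 3} \<and> j \<in> {1, 2, 3} \<and> i \<noteq> j} =
      min (mu G a b) (min (mu G b c) (mu G a c))"
    by (simp only:) simp
  have eqs: "(\<forall>i \<in> {1, 2, 3}. \<forall>j k. {j, k} = {1, 2, 3} - {i} \<longrightarrow>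
      int (mu G u (v i)) = int (mu G (v i) (v j)) + int (mu G (v i) (v k)) - m) \<longleftrightarrow>
      int (mu G u a) = int (mu G a b) + int (mu G a c) - m \<and>
      int (mu G u b) = int (mu G a b) + int (mu G b c) - m \<and>
      int (mu G u c) = int (mu G a c) + int (mu G b c) - m" for m
  proof -
    have diffs: "{1, 2, 3} - {1} = {2, 3 :: nat}" "{1, 2, 3} - {2} = {1, 3 :: nat}"
      "{1, 2, 3} - {3} = {1, 2 :: nat}"
      by auto
    have pair: "(\<forall>j k. {j, k} = {p, q} \<longrightarrow> Q j k) \<longleftrightarrow> Q p q \<and> Q q p" for p q :: nat and Q
      by (auto simp: doubleton_eq_iff)
    show ?thesis
      unfolding ball_simps diffs pair abc
      by (auto simp: mu_commute[of G b a] mu_commute[of G c a] mu_commute[of G c b])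
  qed
  define t where "t w x = (\<Sum>T \<in> {T \<in> triangles G. x \<notin> \<Union> (ends G ` T)}. w T)"
    for w :: "'e set \<Rightarrow> rat" and x
  have t_nonneg: "0 \<le> t w x" if "rational_K3_decomposition G w" for w x
    using that unfolding t_def rational_K3_decomposition_def by (auto intro: sum_nonneg)
  have sums: "of_nat (card (edge_class G S)) = sum (t w) (verts G - S)"
    if "rational_K3_decomposition G w" "S \<subseteq> verts G" "card S = 2" for w S
    unfolding t_def by (rule card_edge_class_eq_sum_types[OF G V4 that])
  have to_int: "int p = int q + int r - m"
    if "rat_of_nat p = rat_of_nat q + rat_of_nat r - rat_of_int m" for p q r m
  proof -
    have "rat_of_int (int p) = rat_of_int (int q + int r - m)"
      using that by (simp only: of_int_add of_int_diff of_int_of_nat_eq)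
    then show ?thesis by (simp only: of_int_eq_iff)
  qed
  have int_only_if: "\<exists>n. 0 \<le> n \<and> n \<le> int (min (mu G a b) (min (mu G b c) (mu G a c))) \<and>
      int (mu G u a) = int (mu G a b) + int (mu G a c) - 2 * n \<and>
      int (mu G u b) = int (mu G a b) + int (mu G b c) - 2 * n \<and>
      int (mu G u c) = int (mu G a c) + int (mu G b c) - 2 * n" if dec: "K3_decomposable G"
  proof -
    obtain P where P: "partition_on (edges G) P" "P \<subseteq> triangles G"
      using dec by (auto simp: K3_decomposable_def)
    let ?w = "\<lambda>T. of_bool (T \<in> P) :: rat"
    have w: "rational_K3_decomposition G ?w"
      by (rule indicator_rational_K3_decomposition[OF G P])
    note solve = type_sums_solve[OF V d sums[OF w] t_nonneg[OF w]]
    define n where "n = card ({T \<in> triangles G. u \<notin> \<Union> (ends G ` T)} \<inter> P)"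
    have n: "t ?w u = rat_of_int (int n)"
      using finite_triangles[OF G] by (simp add: t_def n_def)
    show ?thesis
    proof (intro exI[of _ "int n"] conjI)
      show "int n \<le> int (min (mu G a b) (min (mu G b c) (mu G a c)))"
        using solve(1-3) unfolding n by simp
      show "int (mu G u a) = int (mu G a b) + int (mu G a c) - 2 * int n"
        "int (mu G u b) = int (mu G a b) + int (mu G b c) - 2 * int n"
        "int (mu G u c) = int (mu G a c) + int (mu G b c) - 2 * int n"
        by (rule to_int; use solve(4-6) n in simp)+
    qed simp
  qed
  have int_if: "K3_decomposable G"
    if "0 \<le> n" "n \<le> int (min (mu G a b) (min (mu G b c) (mu G a c)))"
      "int (mu G u a) = int (mu G a b) + int (mu G a c) - 2 * n"
      "int (mu G u b) = int (mu G a b) + int (mu G b c) - 2 * n"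
      "int (mu G u c) = int (mu G a c) + int (mu G b c) - 2 * n" for n
  proof -
    have "\<exists>t :: 'v \<Rightarrow> nat. \<forall>S. S \<subseteq> verts G \<and> card S = 2 \<longrightarrow>
        1 * card (edge_class G S) = (\<Sum>x \<in> verts G - S. t x)"
      by (rule type_counts_exist[OF V d, of n]) (use that in auto)
    then obtain t :: "'v \<Rightarrow> nat" where "\<And>S. S \<subseteq> verts G \<Longrightarrow> card S = 2 \<Longrightarrow>
        card (edge_class G S) = (\<Sum>x \<in> verts G - S. t x)"
      by auto
    then show ?thesis by (rule K3_decomposable_if_card_edge_class[OF G V4])
  qed
  have rat_only_if: "\<exists>n'. 0 \<le> rat_of_int n' / 2 \<and>
      rat_of_int n' / 2 \<le> rat_of_nat (min (mu G a b) (min (mu G b c) (mu G a c))) \<and>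
      int (mu G u a) = int (mu G a b) + int (mu G a c) - n' \<and>
      int (mu G u b) = int (mu G a b) + int (mu G b c) - n' \<and>
      int (mu G u c) = int (mu G a c) + int (mu G b c) - n'" if dec: "rationally_K3_decomposable G"
  proof -
    obtain w where w: "rational_K3_decomposition G w"
      using dec by (auto simp: rationally_K3_decomposable_def)
    note solve = type_sums_solve[OF V d sums[OF w] t_nonneg[OF w]]
    define n' where "n' = int (mu G a b) + int (mu G a c) - int (mu G u a)"
    have n': "t w u = rat_of_int n' / 2"
      using solve(4) by (simp add: n'_def)
    show ?thesis
    proof (intro exI[of _ n'] conjI)
      show "0 \<le> rat_of_int n' / 2" using t_nonneg[OF w] unfolding n'[symmetric] .
      show "rat_of_int n' / 2 \<le> rat_of_nat (min (mu G a b) (min (mu G b c) (mu G a c)))"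
        using solve(1-3) unfolding n'[symmetric] by (simp add: min_def)
      show "int (mu G u a) = int (mu G a b) + int (mu G a c) - n'"
        "int (mu G u b) = int (mu G a b) + int (mu G b c) - n'"
        "int (mu G u c) = int (mu G a c) + int (mu G b c) - n'"
        by (rule to_int; use solve(4-6) n' in simp)+
    qed
  qed
  have half: "\<exists>w. rational_K3_decomposition G w \<and> (\<forall>T \<in> triangles G. w T \<in> {0, 1, 1 / 2})"
    if "0 \<le> rat_of_int n' / 2"
      "rat_of_int n' / 2 \<le> rat_of_nat (min (mu G a b) (min (mu G b c) (mu G a c)))"
      "int (mu G u a) = int (mu G a b) + int (mu G a c) - n'"
      "int (mu G u b) = int (mu G a b) + int (mu G b c) - n'"
      "int (mu G u c) = int (mu G a c) + int (mu G b c) - n'" for n'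
  proof -
    have "rat_of_int n' \<le> rat_of_int (2 * int (min (mu G a b) (min (mu G b c) (mu G a c))))"
      unfolding of_int_mult of_int_numeral of_int_of_nat_eq using that(2) by linarith
    then have "n' \<le> 2 * int (min (mu G a b) (min (mu G b c) (mu G a c)))"
      by (simp only: of_int_le_iff)
    moreover have "0 \<le> n'" using that(1) by simp
    ultimately have "\<exists>t :: 'v \<Rightarrow> nat. \<forall>S. S \<subseteq> verts G \<and> card S = 2 \<longrightarrow>
        2 * card (edge_class G S) = (\<Sum>x \<in> verts G - S. t x)"
      by (intro type_counts_exist[OF V d, of n']) (use that(3-5) in auto)
    then obtain t :: "'v \<Rightarrow> nat" where t: "\<And>S. S \<subseteq> verts (doubled G) \<Longrightarrow> card S = 2 \<Longrightarrow>
        card (edge_class (doubled G) S) = (\<Sum>x \<in> verts (doubled G) - S. t x)"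
      by (auto simp: card_edge_class_doubled)
    have "K3_decomposable (doubled G)"
      by (rule K3_decomposable_if_card_edge_class[OF multigraph_doubled[OF G] _ t])
        (simp_all add: V4)
    then show ?thesis by (rule half_integral_decomposition[OF G])
  qed
  have rationally_if: "rationally_K3_decomposable G"
    if "\<exists>w. rational_K3_decomposition G w \<and> (\<forall>T \<in> triangles G. w T \<in> {0, 1, 1 / 2})"
    using that unfolding rationally_K3_decomposable_def by blast
  show ?thesis
    unfolding Min eqs
    apply (intro conjI iffI impI)
    subgoal by (rule int_only_if)
    subgoal by (elim exE conjE) (rule int_if)
    subgoal by (rule rat_only_if)
    subgoal by (elim exE conjE) (rule rationally_if[OF half])
    subgoal by (drule rat_only_if, elim exE conjE) (rule half)
    done
qed

end
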